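(* (a) $\mathcal A_{23} = \mathcal A_{25} = \mathcal C_{25} = \mathcal D_{25} = \mathcal E_{25}$; (b) $\mathcal A_{12} = \mathcal B_{13} = \mathcal D_{12} = \mathcal D_{35} = \mathcal F_{13}$; (c) $\mathcal A_{35} = \mathcal F_{25}$; (d) $\mathcal B_{25} = \mathcal S$.
   Context: A zroupoid is an algebra $\langle A,\to,0\rangle$ with $\to$ binary and $0$ a constant; write $x' := x\to 0$. An implication zroupoid ($\mathcal I$-zroupoid) is a zroupoid satisfying (I) $(x\to y)\to z \approx ((z'\to x)\to(y\to z)')'$ and (I$_0$) $0''\approx 0$. Let $\mathcal S$ be the variety of $\mathcal I$-zroupoids satisfying $x''\approx x$ and $(x\to y')'\approx (y\to x')'$. Identities of Bol-Moufang type: consider the six words in variables $x,y,z$: A: $xxyz$, B: $xyxz$, C: $xyyz$, D: $xyzx$, E: $xyzy$, F: $xyzz$, and the five bracketings of a word $o_1o_2o_3o_4$: 1: $o_1\to(o_2\to(o_3\to o_4))$; 2: $o_1\to((o_2\to o_3)\to o_4)$; 3: $(o_1\to o_2)\to(o_3\to o_4)$; 4: $(o_1\to(o_2\to o_3))\to o_4$; 5: $((o_1\to o_2)\to o_3)\to o_4$. For $X\in\{A,\dots,F\}$ and $1\le i<j\le 5$, $(X_{ij})$ is the identity whose left side is word $X$ bracketed by $i$ and whose right side is word $X$ bracketed by $j$ (e.g. $(A_{23})$: $x\to((x\to y)\to z)\approx (x\to x)\to(y\to z)$). $\mathcal X_{ij}$ denotes the subvariety of $\mathcal S$ defined by $(X_{ij})$.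 *)

theory Defs
  imports Main
begin

record 'a zroupoid =
  carrier :: "'a set"
  imp :: "'a \<Rightarrow> 'a \<Rightarrow> 'a"
  zero :: 'a

definition is_zroupoid :: "'a zroupoid \<Rightarrow> bool" where
  "is_zroupoid G \<longleftrightarrow>
     zero G \<in> carrier G \<and>
     (\<forall>a\<in>carrier G. \<forall>b\<in>carrier G. imp G a b \<in> carrier G)"

datatype trm = Var nat | Zero | Imp trm trm (infixr "\<rightarrow>\<^sub>z" 65)

abbreviation prime :: "trm \<Rightarrow> trm" ("_\<acute>" [1000] 1000) where
  "t\<acute> \<equiv> t \<rightarrow>\<^sub>z Zero"

type_synonym identity = "trm \<times> trm"

abbreviation Approx :: "trm \<Rightarrow> trm \<Rightarrow> identity" (infix "\<approx>" 50) where
  "s \<approx> t \<equiv> (s, t)"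

primrec eval :: "'a zroupoid \<Rightarrow> (nat \<Rightarrow> 'a) \<Rightarrow> trm \<Rightarrow> 'a" where
  "eval G v (Var n) = v n"
| "eval G v Zero = zero G"
| "eval G v (s \<rightarrow>\<^sub>z t) = imp G (eval G v s) (eval G v t)"

definition satisfies :: "'a zroupoid \<Rightarrow> identity \<Rightarrow> bool" where
  "satisfies G e \<longleftrightarrow>
     (\<forall>v. range v \<subseteq> carrier G \<longrightarrow> eval G v (fst e) = eval G v (snd e))"

text \<open>
  A variety is represented by its members whose carrier is a set of elements of the
  type \<open>'a\<close>; statements about varieties are to be read for arbitrary \<open>'a\<close>.
\<close>

definition variety :: "identity set \<Rightarrow> 'a zroupoid set" where
  "variety E = {G. is_zroupoid G \<and> (\<forall>e\<in>E. satisfies G e)}"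

abbreviation vx :: trm where "vx \<equiv> Var 0"
abbreviation vy :: trm where "vy \<equiv> Var 1"
abbreviation vz :: trm where "vz \<equiv> Var 2"

definition I_identities :: "identity set" where
  "I_identities =
     {(vx \<rightarrow>\<^sub>z vy) \<rightarrow>\<^sub>z vz \<approx> ((vz\<acute> \<rightarrow>\<^sub>z vx) \<rightarrow>\<^sub>z (vy \<rightarrow>\<^sub>z vz)\<acute>)\<acute>,
      Zero\<acute>\<acute> \<approx> Zero}"

definition S_identities :: "identity set" where
  "S_identities = I_identities \<union>
     {vx\<acute>\<acute> \<approx> vx,
      (vx \<rightarrow>\<^sub>z vy\<acute>)\<acute> \<approx> (vy \<rightarrow>\<^sub>z vx\<acute>)\<acute>}"

definition S_variety :: "'a zroupoid set" where
  "S_variety = variety S_identities"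

datatype bm_word = WA | WB | WC | WD | WE | WF

primrec letters :: "bm_word \<Rightarrow> trm \<times> trm \<times> trm \<times> trm" where
  "letters WA = (vx, vx, vy, vz)"
| "letters WB = (vx, vy, vx, vz)"
| "letters WC = (vx, vy, vy, vz)"
| "letters WD = (vx, vy, vz, vx)"
| "letters WE = (vx, vy, vz, vy)"
| "letters WF = (vx, vy, vz, vz)"

datatype bracketing = Br1 | Br2 | Br3 | Br4 | Br5

primrec bracket :: "bracketing \<Rightarrow> trm \<times> trm \<times> trm \<times> trm \<Rightarrow> trm" where
  "bracket Br1 w = (case w of (o1, o2, o3, o4) \<Rightarrow> o1 \<rightarrow>\<^sub>z (o2 \<rightarrow>\<^sub>z (o3 \<rightarrow>\<^sub>z o4)))"
| "bracket Br2 w = (case w of (o1, o2, o3, o4) \<Rightarrow> o1 \<rightarrow>\<^sub>z ((o2 \<rightarrow>\<^sub>z o3) \<rightarrow>\<^sub>z o4))"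
| "bracket Br3 w = (case w of (o1, o2, o3, o4) \<Rightarrow> (o1 \<rightarrow>\<^sub>z o2) \<rightarrow>\<^sub>z (o3 \<rightarrow>\<^sub>z o4))"
| "bracket Br4 w = (case w of (o1, o2, o3, o4) \<Rightarrow> (o1 \<rightarrow>\<^sub>z (o2 \<rightarrow>\<^sub>z o3)) \<rightarrow>\<^sub>z o4)"
| "bracket Br5 w = (case w of (o1, o2, o3, o4) \<Rightarrow> ((o1 \<rightarrow>\<^sub>z o2) \<rightarrow>\<^sub>z o3) \<rightarrow>\<^sub>z o4)"

definition bol_moufang :: "bm_word \<Rightarrow> bracketing \<Rightarrow> bracketing \<Rightarrow> identity" where
  "bol_moufang X i j = (bracket i (letters X) \<approx> bracket j (letters X))"

lemma bol_moufang_A23: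
  "bol_moufang WA Br2 Br3 =
     (vx \<rightarrow>\<^sub>z ((vx \<rightarrow>\<^sub>z vy) \<rightarrow>\<^sub>z vz) \<approx> (vx \<rightarrow>\<^sub>z vx) \<rightarrow>\<^sub>z (vy \<rightarrow>\<^sub>z vz))"
  by (simp add: bol_moufang_def)

definition S_sub :: "bm_word \<Rightarrow> bracketing \<Rightarrow> bracketing \<Rightarrow> 'a zroupoid set" where
  "S_sub X i j = variety (S_identities \<union> {bol_moufang X i j})"

end

theory Submission
  imports Defs
begin

text \<open>
  Put \<open>x \<oplus> y = x' \<rightarrow> y\<close> and \<open>x \<odot> y = (x \<rightarrow> y')'\<close>. Then (I) says that \<open>\<oplus>\<close> distributes over
  \<open>\<odot>\<close>, so the members of \<open>\<S>\<close> are De Morgan algebras in which absorption may fail: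
  \<open>\<oplus>\<close> and \<open>\<odot>\<close> are semilattice operations with units \<open>0\<close> and \<open>1 = 0'\<close>, distributing over each
  other, and exchanged by the involution. Rewritten in these operations, the identities of (a)
  all say \<open>0 = 1\<close>, those of (b) say \<open>x \<oplus> x' = x \<oplus> 1\<close>, and those of (c) say
  \<open>x \<oplus> x' \<oplus> 1 = x \<oplus> x'\<close>, while (B25) always holds.
\<close>

section \<open>Distributive bisemilattices with units\<close>

text \<open>The axioms are those that can be read off from the identities of
  \<open>S_variety\<close>. Idempotence and associativity of both operations are derived below from
  distributivity and the units.\<close>

locale dist_bisemilattice =
  fixes A :: "'a set"
    and join :: "'a \<Rightarrow> 'a \<Rightarrow> 'a" (infixl "\<oplus>" 65)
    and meet :: "'a \<Rightarrow> 'a \<Rightarrow> 'a" (infixl "\<odot>" 70)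
    and bottom :: 'a ("\<zero>")
    and top :: 'a ("\<one>")
  assumes join_closed [simp]: "x \<in> A \<Longrightarrow> y \<in> A \<Longrightarrow> x \<oplus> y \<in> A"
    and meet_closed [simp]: "x \<in> A \<Longrightarrow> y \<in> A \<Longrightarrow> x \<odot> y \<in> A"
    and bottom_closed [simp]: "\<zero> \<in> A"
    and top_closed [simp]: "\<one> \<in> A"
    and join_comm: "x \<in> A \<Longrightarrow> y \<in> A \<Longrightarrow> x \<oplus> y = y \<oplus> x"
    and meet_comm: "x \<in> A \<Longrightarrow> y \<in> A \<Longrightarrow> x \<odot> y = y \<odot> x"
    and join_bottom [simp]: "x \<in> A \<Longrightarrow> x \<oplus> \<zero> = x"
    and meet_top [simp]: "x \<in> A \<Longrightarrow> x \<odot> \<one> = x"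
    and join_meet_distrib:
      "x \<in> A \<Longrightarrow> y \<in> A \<Longrightarrow> z \<in> A \<Longrightarrow> x \<oplus> y \<odot> z = (x \<oplus> y) \<odot> (x \<oplus> z)"
    and meet_join_distrib:
      "x \<in> A \<Longrightarrow> y \<in> A \<Longrightarrow> z \<in> A \<Longrightarrow> x \<odot> (y \<oplus> z) = x \<odot> y \<oplus> x \<odot> z"

text \<open>The axioms are self-dual, so every lemma of the locale is also available under the
  prefix \<open>dual\<close>, with the two operations and the two units exchanged.\<close>

sublocale dist_bisemilattice \<subseteq> dual: dist_bisemilattice A meet join top bottom
  by unfold_locales (auto intro: join_comm meet_comm join_meet_distrib meet_join_distrib)

section \<open>Idempotence and the failure of absorption\<close>

lemma (in dist_bisemilattice) bottom_join [simp]: "x \<in> A \<Longrightarrow> \<zero> \<oplus> x = x"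
  using join_comm[of \<zero> x] by simp

text \<open>Expand \<open>\<zero> \<odot> (\<one> \<oplus> \<zero>)\<close> in two ways.\<close>

lemma (in dist_bisemilattice) bottom_meet_bottom: "\<zero> \<odot> \<zero> = \<zero>"
  using meet_join_distrib[of \<zero> \<one> \<zero>] by simp

lemma (in dist_bisemilattice) meet_idem [simp]: "x \<in> A \<Longrightarrow> x \<odot> x = x"
  using join_meet_distrib[of x \<zero> \<zero>] by (simp add: bottom_meet_bottom)

lemma (in dist_bisemilattice) meet_join_self: "x \<in> A \<Longrightarrow> y \<in> A \<Longrightarrow> x \<odot> (x \<oplus> y) = x \<oplus> x \<odot> y"
  by (simp add: meet_join_distrib)

text \<open>Both sides equal \<open>x \<odot> (x \<oplus> y)\<close>. Absorption thus fails only by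
  the summand \<open>\<zero> \<odot> y\<close>, and summands of this kind carry the arguments up to
  associativity.\<close>

lemma (in dist_bisemilattice) join_meet_self: "x \<in> A \<Longrightarrow> y \<in> A \<Longrightarrow> x \<oplus> x \<odot> y = x \<oplus> \<zero> \<odot> y"
  using join_meet_distrib[of x \<zero> y] by (simp add: meet_join_self)

lemma (in dist_bisemilattice) meet_top_join: "x \<in> A \<Longrightarrow> y \<in> A \<Longrightarrow> x \<odot> (\<one> \<oplus> y) = x \<oplus> \<zero> \<odot> y"
  by (simp add: meet_join_distrib join_meet_self)

lemma (in dist_bisemilattice) join_top_meet_join: "x \<in> A \<Longrightarrow> y \<in> A \<Longrightarrow> (x \<oplus> \<one>) \<odot> (x \<oplus> y) = x \<oplus> y"
  using join_meet_distrib[of x \<one> y] by simp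

text \<open>Expanding one factor of the idempotent product
  \<open>(x \<oplus> \<one>) \<odot> (x \<oplus> \<one>)\<close> produces the extra summand
  \<open>x\<close>.\<close>

lemma (in dist_bisemilattice) join_join_top: "x \<in> A \<Longrightarrow> x \<oplus> (x \<oplus> \<one>) = x \<oplus> \<one>"
proof -
  assume x: "x \<in> A"
  have "(x \<oplus> \<one>) \<odot> (x \<oplus> \<one>) = (x \<oplus> \<one>) \<odot> x \<oplus> (x \<oplus> \<one>) \<odot> \<one>"
    using x by (intro meet_join_distrib) auto
  moreover have "(x \<oplus> \<one>) \<odot> x = x"
    using x join_top_meet_join[of x \<zero>] by simp
  ultimately show ?thesis using x by simp
qed

lemma (in dist_bisemilattice) meet_join_meet_bottom: "x \<in> A \<Longrightarrow> y \<in> A \<Longrightarrow> x \<odot> (y \<oplus> x \<odot> \<zero>) = x \<odot> y"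
  using meet_join_distrib[of x y "x \<odot> \<zero>"] meet_join_distrib[of x y \<zero>]
  by (simp add: dual.join_join_top)

text \<open>The inner meet is \<open>y \<oplus> \<zero> \<odot> x\<close>, and a factor
  \<open>x\<close> cancels the summand \<open>\<zero> \<odot> x\<close>. The dual is the substitute
  for absorption in the next proofs.\<close>

lemma (in dist_bisemilattice) meet_meet_join: "x \<in> A \<Longrightarrow> y \<in> A \<Longrightarrow> x \<odot> (y \<odot> (y \<oplus> x)) = x \<odot> y"
  using meet_join_meet_bottom[of x y]
    by (simp add: meet_join_self join_meet_self meet_comm[of x \<zero>])

lemma (in dist_bisemilattice) top_join_top_join: "x \<in> A \<Longrightarrow> \<one> \<oplus> (\<one> \<oplus> x) = \<one> \<oplus> x"
proof -
  assume x: "x \<in> A"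
  have *: "\<one> \<oplus> \<zero> \<odot> y = \<one> \<oplus> y" if "y \<in> A" for y
    using that meet_top_join[of \<one> y] meet_comm[of \<one> "\<one> \<oplus> y"] by simp
  have "\<one> \<oplus> (\<one> \<oplus> x) = \<one> \<oplus> \<zero> \<odot> (\<one> \<oplus> x)"
    using x by (simp add: *)
  also have "\<dots> = \<one> \<oplus> x"
    using x by (simp add: meet_join_distrib *)
  finally show ?thesis .
qed

lemma (in dist_bisemilattice) join_left_idem:
  assumes x: "x \<in> A" and y: "y \<in> A"
  shows "x \<oplus> (x \<oplus> y) = x \<oplus> y"
proof -
  have absorb: "b \<oplus> a \<odot> (a \<oplus> b) = a \<oplus> b" if "a \<in> A" "b \<in> A" for a b
    using that dual.meet_meet_join[of b a] by (simp add: meet_join_self join_comm)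
  \<comment> \<open>The aim is to turn this into \<open>x \<odot> (x \<oplus> y)\<close>. Then
    \<open>absorb\<close>, applied to \<open>x\<close> and \<open>x \<oplus> y\<close>, removes a
    nested join, and the factor \<open>x \<oplus> \<one>\<close> that remains has no effect on
    \<open>x \<oplus> y\<close>.\<close>
  have "x \<oplus> \<zero> \<odot> (x \<oplus> y) = x \<oplus> \<zero> \<odot> (y \<oplus> \<zero> \<odot> x)"
    using x y by (simp add: meet_join_distrib dual.top_join_top_join join_comm)
  also have "\<dots> = x \<odot> (x \<oplus> (y \<oplus> \<zero> \<odot> x))"
    using x y by (simp add: meet_join_self join_meet_self)
  also have "x \<oplus> (y \<oplus> \<zero> \<odot> x) = x \<oplus> y"
    using x y absorb[of y x] by (simp add: meet_join_self join_meet_self join_comm[of x y])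
  finally have "x \<oplus> \<zero> \<odot> (x \<oplus> y) = x \<odot> (x \<oplus> y)" .
  then have "x \<odot> (x \<oplus> (x \<oplus> y)) = x \<odot> (x \<oplus> y)"
    using x y by (simp only: meet_join_self[of x "x \<oplus> y"] join_meet_self[of x "x \<oplus> y"] join_closed)
  then have "x \<oplus> (x \<oplus> y) = (x \<oplus> y) \<oplus> x \<odot> (x \<oplus> y)"
    using x y absorb[of x "x \<oplus> y"] by simp
  also have "\<dots> = (x \<oplus> y) \<odot> (x \<oplus> \<one>)"
    using x y meet_join_distrib[of "x \<oplus> y" x \<one>] meet_comm[of "x \<oplus> y" x]
      join_comm[of "x \<oplus> y" "x \<odot> (x \<oplus> y)"] by simp
  also have "\<dots> = x \<oplus> y"
    using x y by (simp add: join_top_meet_join meet_comm[of "x \<oplus> y" "x \<oplus> \<one>"])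
  finally show ?thesis .
qed

section \<open>Summands \<open>\<zero> \<odot> w\<close> and associativity\<close>

lemma (in dist_bisemilattice) meet_join_bottom_meet:
  assumes x: "x \<in> A" and y: "y \<in> A"
  shows "x \<odot> y \<oplus> \<zero> \<odot> y = x \<odot> y"
proof -
  have "(x \<odot> y) \<odot> y = x \<odot> y"
    using x y dual.join_left_idem[of y x] by (simp add: meet_comm)
  then show ?thesis
    using x y join_meet_self[of "x \<odot> y" y] by simp
qed

text \<open>With \<open>b = \<zero> \<odot> x\<close>, the product
  \<open>b \<odot> (b \<oplus> y)\<close> is both \<open>y \<odot> b\<close> and
  \<open>b \<oplus> \<zero> \<odot> y\<close>.\<close>

lemma (in dist_bisemilattice) meet_bottom_meet:
  assumes x: "x \<in> A" and y: "y \<in> A"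
  shows "y \<odot> (\<zero> \<odot> x) = \<zero> \<odot> (x \<oplus> y)"
proof -
  define b where "b = \<zero> \<odot> x"
  have b: "b \<in> A" using x by (simp add: b_def)
  have "\<zero> \<odot> b = b" using x by (simp add: b_def dual.top_join_top_join)
  then have "b \<odot> (b \<oplus> y) = b \<oplus> y \<odot> b"
    using b y by (simp add: meet_join_self meet_comm)
  also have "\<dots> = y \<odot> b"
    using b y \<open>\<zero> \<odot> b = b\<close> meet_join_bottom_meet[of y b] by (simp add: join_comm)
  finally have "y \<odot> b = b \<oplus> \<zero> \<odot> y"
    using b y by (simp add: meet_join_self join_meet_self)
  then show ?thesis
    using x y by (simp add: b_def meet_join_distrib)
qed

text \<open>Adding \<open>\<zero> \<odot> z\<close> is the same as multiplying by \<open>\<one> \<oplus> z\<close>.\<close>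

lemma (in dist_bisemilattice) join_assoc_bottom_meet:
  assumes x: "x \<in> A" and y: "y \<in> A" and z: "z \<in> A"
  shows "(x \<oplus> y) \<oplus> \<zero> \<odot> z = x \<oplus> (y \<oplus> \<zero> \<odot> z)"
proof -
  define t where "t = \<one> \<oplus> z"
  define u where "u = x \<oplus> y"
  have t: "t \<in> A" and u: "u \<in> A" using x y z by (simp_all add: t_def u_def)
  \<comment> \<open>Since \<open>t\<close> contains the summand \<open>\<one>\<close>, adding
    \<open>x\<close> to it amounts to adding \<open>\<zero> \<odot> x\<close>.\<close>
  have "x \<oplus> t = \<one> \<oplus> z \<odot> x"
    using x z dual.meet_bottom_meet[of z x] by (simp add: t_def)
  also have "\<dots> = t \<odot> (\<one> \<oplus> x)"
    using x z by (simp add: t_def join_meet_distrib)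
  also have "\<dots> = t \<oplus> \<zero> \<odot> x"
    using x t by (simp add: meet_top_join)
  finally have xt: "x \<oplus> t = t \<oplus> \<zero> \<odot> x" .
  have ux: "u \<odot> (\<zero> \<odot> x) = \<zero> \<odot> u"
    using x y u by (simp add: meet_bottom_meet) (simp add: u_def join_left_idem)
  have "x \<oplus> (y \<oplus> \<zero> \<odot> z) = x \<oplus> y \<odot> t"
    using y z by (simp add: t_def meet_top_join)
  also have "\<dots> = u \<odot> (t \<oplus> \<zero> \<odot> x)"
    using x y t by (simp add: u_def join_meet_distrib flip: xt)
  also have "\<dots> = t \<odot> u \<oplus> \<zero> \<odot> u"
    using x t u by (simp add: meet_join_distrib ux meet_comm[of u t])
  also have "\<dots> = u \<odot> t"
    using t u by (simp add: meet_join_bottom_meet meet_comm[of u t])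
  also have "\<dots> = (x \<oplus> y) \<oplus> \<zero> \<odot> z"
    using z u by (simp add: t_def meet_top_join) (simp add: u_def)
  finally show ?thesis by simp
qed

text \<open>
  The usual argument for lattices, which shows that the meet of the two bracketings equals
  both of them, up to summands \<open>\<zero> \<odot> w\<close> that replace absorption.
\<close>

lemma (in dist_bisemilattice) join_assoc:
  assumes x: "x \<in> A" and y: "y \<in> A" and z: "z \<in> A"
  shows "(x \<oplus> y) \<oplus> z = x \<oplus> (y \<oplus> z)"
proof -
  \<comment> \<open>The facts up to \<open>add\<close> allow summands
    \<open>\<zero> \<odot> w\<close> to be moved to the end, split, permuted and merged before
    associativity is known for the other summands.\<close>
  have shift: "a \<oplus> (b \<oplus> \<zero> \<odot> w) = (a \<oplus> b) \<oplus> \<zero> \<odot> w"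
      "(b \<oplus> \<zero> \<odot> w) \<oplus> a = (b \<oplus> a) \<oplus> \<zero> \<odot> w"
    if "a \<in> A" "b \<in> A" "w \<in> A" for a b w
    using that by (simp_all add: join_assoc_bottom_meet join_comm[of _ a])
  have split: "a \<oplus> \<zero> \<odot> (b \<oplus> w) = a \<oplus> \<zero> \<odot> b \<oplus> \<zero> \<odot> w"
    if "a \<in> A" "b \<in> A" "w \<in> A" for a b w
    using that by (simp add: meet_join_distrib shift(1))
  have same: "a \<oplus> \<zero> \<odot> a = a" if "a \<in> A" for a
    using that join_meet_self[of a a] by simp
  have swap: "a \<oplus> \<zero> \<odot> b \<oplus> \<zero> \<odot> w = a \<oplus> \<zero> \<odot> w \<oplus> \<zero> \<odot> b"
    if "a \<in> A" "b \<in> A" "w \<in> A" for a b w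
    using that by (simp add: join_comm[of b w] flip: split)
  have add: "(a \<oplus> \<zero> \<odot> w) \<oplus> (b \<oplus> \<zero> \<odot> w) = (a \<oplus> b) \<oplus> \<zero> \<odot> w"
    if "a \<in> A" "b \<in> A" "w \<in> A" for a b w
    using that split[of "a \<oplus> b" w w] shift(2)[of b a w]
    by (simp add: shift(1)[of "a \<oplus> \<zero> \<odot> w" b w])
  \<comment> \<open>Multiplying any of \<open>a\<close>, \<open>b\<close>, \<open>c\<close> by
    \<open>M\<close> only adds \<open>\<zero> \<odot> M\<close>, so multiplying their left-bracketed
    join by \<open>M\<close> does the same.\<close>
  have key: "((a \<oplus> b) \<oplus> c) \<odot> (a \<oplus> (b \<oplus> c)) = (a \<oplus> b) \<oplus> c"
    if a: "a \<in> A" and b: "b \<in> A" and c: "c \<in> A" for a b c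
  proof -
    define M where "M = a \<oplus> (b \<oplus> c)"
    have M: "M \<in> A" using a b c by (simp add: M_def)
    have zM: "w \<oplus> \<zero> \<odot> M = w \<oplus> \<zero> \<odot> a \<oplus> \<zero> \<odot> b \<oplus> \<zero> \<odot> c" if "w \<in> A" for w
      using a b c that by (simp add: M_def split)
    have aM: "a \<odot> M = a \<oplus> \<zero> \<odot> M"
      using a b c by (simp add: zM same) (simp add: M_def meet_join_self join_meet_self split)
    have bM: "b \<odot> M = b \<oplus> \<zero> \<odot> M"
    proof -
      have "b \<odot> M = a \<odot> b \<oplus> (b \<oplus> \<zero> \<odot> c)"
        using a b c by (simp add: M_def meet_join_distrib join_meet_self meet_comm[of b a])
      also have "\<dots> = (b \<oplus> b \<odot> a) \<oplus> \<zero> \<odot> c"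
        using a b c by (simp add: shift(1) join_comm[of "b \<odot> a" b] meet_comm[of a b])
      also have "\<dots> = b \<oplus> \<zero> \<odot> M"
        using a b c by (simp add: zM join_meet_self swap[of b a b] same)
      finally show ?thesis .
    qed
    have cM: "c \<odot> M = c \<oplus> \<zero> \<odot> M"
    proof -
      have "c \<odot> M = a \<odot> c \<oplus> (c \<oplus> c \<odot> b)"
        using a b c by (simp add: M_def meet_join_distrib meet_comm[of a c] join_comm[of "c \<odot> b" c])
      also have "\<dots> = (c \<oplus> c \<odot> a) \<oplus> \<zero> \<odot> b"
        using a b c by (simp add: join_meet_self[of c b] shift(1) join_comm[of "c \<odot> a" c]
            meet_comm[of a c])
      also have "\<dots> = c \<oplus> \<zero> \<odot> M"
        using a b c by (simp add: zM join_meet_self swap[of _ b c] swap[of c a c] same)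
      finally show ?thesis .
    qed
    define L where "L = (a \<oplus> b) \<oplus> c"
    have L: "L \<in> A" using a b c by (simp add: L_def)
    have "L \<odot> M = M \<odot> a \<oplus> M \<odot> b \<oplus> M \<odot> c"
      using a b c M by (simp add: L_def meet_comm[of "a \<oplus> b \<oplus> c" M] meet_join_distrib)
    also have "\<dots> = L \<oplus> \<zero> \<odot> M"
      using a b c M
      by (simp add: meet_comm[of M a] meet_comm[of M b] meet_comm[of M c] aM bM cM add L_def)
    \<comment> \<open>As summands, \<open>\<zero> \<odot> M\<close> and
      \<open>\<zero> \<odot> L\<close> split into the same three terms, whatever the
      bracketing.\<close>
    also have "\<dots> = L \<oplus> \<zero> \<odot> L"
      using a b c L by (simp add: zM) (simp add: L_def split)
    finally show ?thesis
      using L by (simp add: same L_def M_def)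
  qed
  define M where "M = x \<oplus> (y \<oplus> z)"
  \<comment> \<open>The mirror image of \<open>key\<close>: reversing the three letters exchanges
    the two bracketings up to commutativity.\<close>
  have "M \<odot> ((x \<oplus> y) \<oplus> z) = M"
    using x y z key[of z y x] by (simp add: M_def join_comm)
  then show ?thesis
    using x y z key[of x y z] by (simp add: M_def meet_comm)
qed

lemma (in dist_bisemilattice) join_left_comm:
  "x \<in> A \<Longrightarrow> y \<in> A \<Longrightarrow> z \<in> A \<Longrightarrow> x \<oplus> (y \<oplus> z) = y \<oplus> (x \<oplus> z)"
  by (simp add: join_comm[of x y] flip: join_assoc)

lemmas (in dist_bisemilattice) join_ac = join_assoc join_comm join_left_comm

text \<open>Beside the summand \<open>\<one>\<close>, meets and joins are indistinguishable; this is
  the dual of \<open>meet_bottom_meet\<close>.\<close>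

lemma (in dist_bisemilattice) top_join_meet:
  "x \<in> A \<Longrightarrow> y \<in> A \<Longrightarrow> \<one> \<oplus> x \<odot> y = \<one> \<oplus> (x \<oplus> y)"
  using dual.meet_bottom_meet[of x y] by (simp add: join_ac)

section \<open>The Bol-Moufang identities in De Morgan bisemilattices\<close>

text \<open>The implication is a parameter of its own so that the identities can be stated in the
  form that evaluation of terms produces.\<close>

locale demorgan_bisemilattice = dist_bisemilattice +
  fixes neg :: "'a \<Rightarrow> 'a" ("\<sim> _" [90] 90)
    and imp :: "'a \<Rightarrow> 'a \<Rightarrow> 'a" (infixr "\<leadsto>" 60)
  assumes neg_closed [simp]: "x \<in> A \<Longrightarrow> \<sim> x \<in> A"
    and neg_neg [simp]: "x \<in> A \<Longrightarrow> \<sim> \<sim> x = x"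
    and neg_join [simp]: "x \<in> A \<Longrightarrow> y \<in> A \<Longrightarrow> \<sim> (x \<oplus> y) = \<sim> x \<odot> \<sim> y"
    and neg_meet [simp]: "x \<in> A \<Longrightarrow> y \<in> A \<Longrightarrow> \<sim> (x \<odot> y) = \<sim> x \<oplus> \<sim> y"
    and neg_bottom [simp]: "\<sim> \<zero> = \<one>"
    and imp_eq [simp]: "x \<in> A \<Longrightarrow> y \<in> A \<Longrightarrow> x \<leadsto> y = \<sim> x \<oplus> y"
begin

lemma neg_top [simp]: "\<sim> \<one> = \<zero>"
  using neg_neg[of \<zero>] by simp

section \<open>Identities that force the units to coincide\<close>

lemma meet_eq_join_if_trivial:
  assumes "\<zero> = \<one>" "x \<in> A" "y \<in> A"
  shows "x \<odot> y = x \<oplus> y"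
  using meet_top_join[of x y] assms(2,3) dual.bottom_join[of y] bottom_join[of y]
  by (simp flip: assms(1))

text \<open>Evaluation at the units gives \<open>\<one> = \<zero>\<close>. Conversely, once meet and
  join agree, bracketings 2 and 5 are joins of the same four signed letters, and bracketing 3
  differs only in the signs of the first two letters, which coincide in word A. The next four proofs
  follow the same pattern.\<close>

lemma trivial_iff_A23:
  "(\<forall>x\<in>A. \<forall>y\<in>A. \<forall>z\<in>A. x \<leadsto> (x \<leadsto> y) \<leadsto> z = (x \<leadsto> x) \<leadsto> y \<leadsto> z) \<longleftrightarrow> \<zero> = \<one>"
  (is "?L \<longleftrightarrow> ?R")
proof
  assume ?L
  from this[rule_format, of \<one> \<one> \<zero>] this[rule_format, of \<zero> \<one> \<zero>] show ?R by simp
next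
  assume ?R
  then show ?L by (simp add: meet_eq_join_if_trivial join_ac)
qed

lemma trivial_iff_A25:
  "(\<forall>x\<in>A. \<forall>y\<in>A. \<forall>z\<in>A. x \<leadsto> (x \<leadsto> y) \<leadsto> z = ((x \<leadsto> x) \<leadsto> y) \<leadsto> z) \<longleftrightarrow> \<zero> = \<one>"
  (is "?L \<longleftrightarrow> ?R")
proof
  assume ?L
  from this[rule_format, of \<zero> \<one> \<zero>] show ?R by (simp add: bottom_meet_bottom)
next
  assume ?R
  then show ?L by (simp add: meet_eq_join_if_trivial join_ac)
qed

lemma trivial_iff_C25:
  "(\<forall>x\<in>A. \<forall>y\<in>A. \<forall>z\<in>A. x \<leadsto> (y \<leadsto> y) \<leadsto> z = ((x \<leadsto> y) \<leadsto> y) \<leadsto> z) \<longleftrightarrow> \<zero> = \<one>"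
  (is "?L \<longleftrightarrow> ?R")
proof
  assume ?L
  from this[rule_format, of \<zero> \<one> \<zero>] show ?R by simp
next
  assume ?R
  then show ?L by (simp add: meet_eq_join_if_trivial join_ac)
qed

lemma trivial_iff_D25:
  "(\<forall>x\<in>A. \<forall>y\<in>A. \<forall>z\<in>A. x \<leadsto> (y \<leadsto> z) \<leadsto> x = ((x \<leadsto> y) \<leadsto> z) \<leadsto> x) \<longleftrightarrow> \<zero> = \<one>"
  (is "?L \<longleftrightarrow> ?R")
proof
  assume ?L
  from this[rule_format, of \<zero> \<one> \<one>] show ?R by simp
next
  assume ?R
  then show ?L by (simp add: meet_eq_join_if_trivial join_ac)
qed

lemma trivial_iff_E25:
  "(\<forall>x\<in>A. \<forall>y\<in>A. \<forall>z\<in>A. x \<leadsto> (y \<leadsto> z) \<leadsto> y = ((x \<leadsto> y) \<leadsto> z) \<leadsto> y) \<longleftrightarrow> \<zero> = \<one>"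
  (is "?L \<longleftrightarrow> ?R")
proof
  assume ?L
  from this[rule_format, of \<zero> \<zero> \<one>] show ?R by (simp add: bottom_meet_bottom)
next
  assume ?R
  then show ?L by (simp add: meet_eq_join_if_trivial join_ac)
qed

section \<open>Identities equivalent to \<open>fibrewise_boolean\<close>\<close>

text \<open>
  Every distributive bisemilattice is a Plonka sum of distributive lattices; \<open>x \<oplus> \<one>\<close> is the
  greatest element of the fibre of \<open>x\<close>.
\<close>

definition fibrewise_boolean :: bool where
  "fibrewise_boolean \<longleftrightarrow> (\<forall>x\<in>A. x \<oplus> \<sim> x = x \<oplus> \<one>)"

lemma fibrewise_booleanD:
  assumes "fibrewise_boolean" "x \<in> A"
  shows "x \<oplus> \<sim> x = \<one> \<oplus> x" and "\<sim> x \<oplus> x = \<one> \<oplus> x" and "\<one> \<oplus> \<sim> x = \<one> \<oplus> x"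
proof -
  show 1: "x \<oplus> \<sim> x = \<one> \<oplus> x"
    using assms by (simp add: fibrewise_boolean_def join_comm)
  then show 2: "\<sim> x \<oplus> x = \<one> \<oplus> x"
    using assms by (simp add: join_comm)
  have "\<sim> x \<oplus> \<sim> \<sim> x = \<sim> x \<oplus> \<one>"
    using assms unfolding fibrewise_boolean_def by (meson neg_closed)
  then show "\<one> \<oplus> \<sim> x = \<one> \<oplus> x"
    using 2 assms(2) by (simp add: join_comm)
qed

text \<open>The condition splits in two: \<open>x\<close> and \<open>\<sim> x\<close> lie under the
  same fibre top, and \<open>x \<oplus> \<sim> x\<close> is the top of its own fibre. Instances of
  (D12) and (F13) supply the two halves separately.\<close>

lemma fibrewise_booleanI:
  assumes "\<And>x. x \<in> A \<Longrightarrow> \<one> \<oplus> \<sim> x = \<one> \<oplus> x"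
    and "\<And>x. x \<in> A \<Longrightarrow> x \<oplus> \<sim> x = \<one> \<oplus> (x \<oplus> \<sim> x)"
  shows fibrewise_boolean
  unfolding fibrewise_boolean_def
proof
  fix x assume x: "x \<in> A"
  have "x \<oplus> \<sim> x = x \<oplus> (\<one> \<oplus> \<sim> x)"
    using x assms(2)[OF x] by (simp add: join_left_comm[of x])
  also have "\<dots> = x \<oplus> (x \<oplus> \<one>)"
    using x assms(1)[OF x] by (simp add: join_comm)
  finally show "x \<oplus> \<sim> x = x \<oplus> \<one>"
    using x by (simp add: join_left_idem)
qed

text \<open>Distributing gives the factor
  \<open>\<sim> x \<oplus> x = \<one> \<oplus> \<sim> x\<close>, and \<open>x\<close> can then be
  replaced by the neutral factor \<open>\<one>\<close>.\<close>

lemma join_neg_meet_if_fibrewise_boolean: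
  assumes fibrewise_boolean "x \<in> A" "y \<in> A"
  shows "\<sim> x \<oplus> x \<odot> y = \<sim> x \<oplus> y"
  using assms fibrewise_booleanD(2,3)[OF assms(1,2)] dual.bottom_join[of y]
    join_meet_distrib[of "\<sim> x" \<one> y]
  by (simp add: join_meet_distrib join_comm[of "\<sim> x" \<one>])

lemma fibrewise_boolean_iff_A12:
  "(\<forall>x\<in>A. \<forall>y\<in>A. \<forall>z\<in>A. x \<leadsto> x \<leadsto> y \<leadsto> z = x \<leadsto> (x \<leadsto> y) \<leadsto> z) \<longleftrightarrow> fibrewise_boolean"
  (is "?L \<longleftrightarrow> _")
proof
  assume L: ?L
  show fibrewise_boolean
    unfolding fibrewise_boolean_def
  proof
    fix x assume "x \<in> A"
    then show "x \<oplus> \<sim> x = x \<oplus> \<one>"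
      using L[rule_format, of "\<sim> x" \<zero> \<zero>] by (simp add: join_left_idem)
  qed
next
  assume b: fibrewise_boolean
  show ?L
    by (simp add: join_left_idem join_neg_meet_if_fibrewise_boolean[OF b] flip: join_assoc)
qed

lemma fibrewise_boolean_iff_B13:
  "(\<forall>x\<in>A. \<forall>y\<in>A. \<forall>z\<in>A. x \<leadsto> y \<leadsto> x \<leadsto> z = (x \<leadsto> y) \<leadsto> x \<leadsto> z) \<longleftrightarrow> fibrewise_boolean"
proof -
  have "x \<leadsto> y \<leadsto> x \<leadsto> z = x \<leadsto> x \<leadsto> y \<leadsto> z \<and> (x \<leadsto> y) \<leadsto> x \<leadsto> z = x \<leadsto> (x \<leadsto> y) \<leadsto> z"
    if "x \<in> A" "y \<in> A" "z \<in> A" for x y z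
    using that by (simp add: join_left_comm)
  then show ?thesis
    using fibrewise_boolean_iff_A12 by simp
qed

lemma fibrewise_boolean_iff_D12:
  "(\<forall>x\<in>A. \<forall>y\<in>A. \<forall>z\<in>A. x \<leadsto> y \<leadsto> z \<leadsto> x = x \<leadsto> (y \<leadsto> z) \<leadsto> x) \<longleftrightarrow> fibrewise_boolean"
  (is "?L \<longleftrightarrow> _")
proof
  assume L: ?L
  show fibrewise_boolean
  proof (rule fibrewise_booleanI)
    fix x assume x: "x \<in> A"
    show "\<one> \<oplus> \<sim> x = \<one> \<oplus> x"
      using L[rule_format, of \<zero> x \<zero>] x
      by (simp add: join_ac join_left_idem)
    show "x \<oplus> \<sim> x = \<one> \<oplus> (x \<oplus> \<sim> x)"
      using L[rule_format, of x \<zero> \<zero>] x by (simp add: join_ac join_left_idem)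
  qed
next
  assume b: fibrewise_boolean
  show ?L
  proof (intro ballI)
    fix x y z assume xyz: "x \<in> A" "y \<in> A" "z \<in> A"
    have "x \<leadsto> (y \<leadsto> z) \<leadsto> x = (\<sim> x \<oplus> x) \<oplus> y \<odot> \<sim> z"
      using xyz by (simp add: join_ac meet_comm)
    \<comment> \<open>The summand \<open>\<one>\<close> gained here turns the meet into a join and
      allows the sign of \<open>y\<close> to be changed.\<close>
    also have "\<dots> = x \<oplus> (\<one> \<oplus> y \<odot> \<sim> z)"
      using xyz by (simp add: fibrewise_booleanD[OF b] join_ac)
    also have "\<dots> = x \<oplus> ((\<one> \<oplus> \<sim> y) \<oplus> \<sim> z)"
      using xyz by (simp add: top_join_meet fibrewise_booleanD[OF b] join_assoc)
    also have "\<dots> = (\<one> \<oplus> x) \<oplus> (\<sim> y \<oplus> \<sim> z)"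
      using xyz by (simp add: join_ac)
    also have "\<dots> = (\<sim> x \<oplus> x) \<oplus> (\<sim> y \<oplus> \<sim> z)"
      using xyz by (simp add: fibrewise_booleanD[OF b])
    also have "\<dots> = x \<leadsto> y \<leadsto> z \<leadsto> x"
      using xyz by (simp add: join_ac)
    finally show "x \<leadsto> y \<leadsto> z \<leadsto> x = x \<leadsto> (y \<leadsto> z) \<leadsto> x" ..
  qed
qed

lemma fibrewise_boolean_iff_D35:
  "(\<forall>x\<in>A. \<forall>y\<in>A. \<forall>z\<in>A. (x \<leadsto> y) \<leadsto> z \<leadsto> x = ((x \<leadsto> y) \<leadsto> z) \<leadsto> x) \<longleftrightarrow> fibrewise_boolean"
  (is "?L \<longleftrightarrow> _")
proof
  assume L: ?L
  show fibrewise_boolean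
    unfolding fibrewise_boolean_def
  proof
    fix x assume "x \<in> A"
    then show "x \<oplus> \<sim> x = x \<oplus> \<one>"
      using L[rule_format, of x \<zero> \<zero>] by (simp add: join_ac join_left_idem)
  qed
next
  assume b: fibrewise_boolean
  show ?L
  proof (intro ballI)
    fix x y z assume xyz: "x \<in> A" "y \<in> A" "z \<in> A"
    have "((x \<leadsto> y) \<leadsto> z) \<leadsto> x = x \<oplus> (\<sim> x \<oplus> y) \<odot> \<sim> z"
      using xyz by (simp add: join_comm meet_comm)
    also have "\<dots> = ((x \<oplus> \<sim> x) \<oplus> y) \<odot> (x \<oplus> \<sim> z)"
      using xyz by (simp add: join_meet_distrib join_assoc)
    \<comment> \<open>After the sign change, the factor \<open>\<one> \<oplus> \<sim> y\<close>
      becomes the summand \<open>\<zero> \<odot> \<sim> y\<close>, which beside \<open>x\<close> is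
      the same as \<open>x \<odot> \<sim> y\<close>.\<close>
    also have "\<dots> = (x \<oplus> (\<one> \<oplus> \<sim> y)) \<odot> (x \<oplus> \<sim> z)"
      using xyz by (simp add: fibrewise_booleanD[OF b] join_ac)
    also have "\<dots> = x \<oplus> \<sim> z \<odot> (\<one> \<oplus> \<sim> y)"
      using xyz by (simp add: meet_comm flip: join_meet_distrib)
    also have "\<dots> = \<sim> z \<oplus> (x \<oplus> \<zero> \<odot> \<sim> y)"
      using xyz by (simp add: meet_top_join join_left_comm)
    also have "\<dots> = (x \<leadsto> y) \<leadsto> z \<leadsto> x"
      using xyz by (simp add: join_ac meet_comm flip: join_meet_self)
    finally show "(x \<leadsto> y) \<leadsto> z \<leadsto> x = ((x \<leadsto> y) \<leadsto> z) \<leadsto> x" ..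
  qed
qed

lemma fibrewise_boolean_iff_F13:
  "(\<forall>x\<in>A. \<forall>y\<in>A. \<forall>z\<in>A. x \<leadsto> y \<leadsto> z \<leadsto> z = (x \<leadsto> y) \<leadsto> z \<leadsto> z) \<longleftrightarrow> fibrewise_boolean"
  (is "?L \<longleftrightarrow> _")
proof
  assume L: ?L
  show fibrewise_boolean
  proof (rule fibrewise_booleanI)
    fix x assume x: "x \<in> A"
    show "\<one> \<oplus> \<sim> x = \<one> \<oplus> x"
      using L[rule_format, of x \<zero> \<zero>] x
      by (simp add: join_ac join_left_idem)
    show "x \<oplus> \<sim> x = \<one> \<oplus> (x \<oplus> \<sim> x)"
      using L[rule_format, of x \<zero> x] x
      by (simp add: join_ac join_left_idem)
  qed
next
  assume b: fibrewise_boolean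
  show ?L
  proof (intro ballI)
    fix x y z assume xyz: "x \<in> A" "y \<in> A" "z \<in> A"
    have "(x \<leadsto> y) \<leadsto> z \<leadsto> z = z \<oplus> (\<one> \<oplus> x \<odot> \<sim> y)"
      using xyz by (simp add: fibrewise_booleanD[OF b]) (simp add: join_ac)
    also have "\<dots> = z \<oplus> ((\<one> \<oplus> \<sim> x) \<oplus> \<sim> y)"
      using xyz by (simp add: top_join_meet fibrewise_booleanD[OF b] join_assoc)
    also have "\<dots> = \<sim> x \<oplus> (\<sim> y \<oplus> (\<one> \<oplus> z))"
      using xyz by (simp add: join_ac)
    also have "\<dots> = x \<leadsto> y \<leadsto> z \<leadsto> z"
      using xyz by (simp add: fibrewise_booleanD[OF b])
    finally show "x \<leadsto> y \<leadsto> z \<leadsto> z = (x \<leadsto> y) \<leadsto> z \<leadsto> z" ..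
  qed
qed

section \<open>Identities making \<open>x \<oplus> \<sim> x\<close> the top of its fibre\<close>

lemma join_neg_top_iff_A35:
  "(\<forall>x\<in>A. \<forall>y\<in>A. \<forall>z\<in>A. (x \<leadsto> x) \<leadsto> y \<leadsto> z = ((x \<leadsto> x) \<leadsto> y) \<leadsto> z) \<longleftrightarrow>
   (\<forall>x\<in>A. \<one> \<oplus> (x \<oplus> \<sim> x) = x \<oplus> \<sim> x)"
  (is "?L \<longleftrightarrow> ?R")
proof
  assume L: ?L
  show ?R
  proof
    fix x assume x: "x \<in> A"
    then show "\<one> \<oplus> (x \<oplus> \<sim> x) = x \<oplus> \<sim> x"
      using L[rule_format, of x \<zero> \<zero>]
      by (simp add: meet_comm[of "\<sim> x" x] join_comm[of "x \<odot> \<sim> x" \<one>] top_join_meet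
          join_comm[of "\<sim> x" x])
  qed
next
  assume R: ?R
  show ?L
  proof (intro ballI)
    fix x y z assume xyz: "x \<in> A" "y \<in> A" "z \<in> A"
    define v where "v = x \<oplus> \<sim> x"
    have v: "v \<in> A" and v1: "\<one> \<oplus> v = v" using xyz R by (simp_all add: v_def)
    \<comment> \<open>Negating the hypothesis yields
      \<open>x \<odot> \<sim> x = \<zero> \<odot> v\<close>; adding this is multiplying by
      \<open>\<one> \<oplus> v = v\<close>.\<close>
    have "\<sim> (\<one> \<oplus> v) = \<sim> v" using v1 by simp
    then have "x \<odot> \<sim> x = \<zero> \<odot> \<sim> v"
      using xyz v by (simp add: v_def meet_comm)
    also have "\<dots> = \<zero> \<odot> v"
      using xyz dual.top_join_meet[of x "\<sim> x"] by (simp add: v_def meet_comm)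
    finally have "\<sim> y \<oplus> x \<odot> \<sim> x = \<sim> y \<odot> v"
      using xyz v meet_top_join[of "\<sim> y" v] by (simp add: v1)
    then show "(x \<leadsto> x) \<leadsto> y \<leadsto> z = ((x \<leadsto> x) \<leadsto> y) \<leadsto> z"
      using xyz v
      by (simp add: v_def meet_comm[of "\<sim> x" x] join_comm[of "\<sim> x" x]
          meet_comm[of "x \<oplus> \<sim> x" "\<sim> y"] join_comm[of "x \<odot> \<sim> x" "\<sim> y"]
          flip: join_assoc)
  qed
qed

lemma join_neg_top_iff_F25:
  "(\<forall>x\<in>A. \<forall>y\<in>A. \<forall>z\<in>A. x \<leadsto> (y \<leadsto> z) \<leadsto> z = ((x \<leadsto> y) \<leadsto> z) \<leadsto> z) \<longleftrightarrow>
   (\<forall>x\<in>A. \<one> \<oplus> (x \<oplus> \<sim> x) = x \<oplus> \<sim> x)"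
  (is "?L \<longleftrightarrow> ?R")
proof
  assume L: ?L
  show ?R
  proof
    fix z assume z: "z \<in> A"
    have "\<one> \<oplus> (\<zero> \<odot> \<sim> z \<oplus> z) = (\<one> \<oplus> \<zero>) \<odot> \<sim> z \<oplus> z"
      using L[rule_format, of \<zero> \<zero> z] z by simp
    then have "(\<one> \<oplus> \<zero> \<odot> \<sim> z) \<oplus> z = z \<oplus> \<sim> z"
      using z by (simp add: join_assoc join_comm[of z])
    then show "\<one> \<oplus> (z \<oplus> \<sim> z) = z \<oplus> \<sim> z"
      using z by (simp add: top_join_meet join_ac)
  qed
next
  assume R: ?R
  show ?L
  proof (intro ballI)
    fix x y z assume xyz: "x \<in> A" "y \<in> A" "z \<in> A"
    \<comment> \<open>The hypothesis inserts \<open>\<one>\<close> into the factor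
      \<open>z \<oplus> \<sim> z\<close>, so that beside \<open>z\<close> a factor
      \<open>\<sim> z\<close> acts as a summand \<open>\<zero> \<odot> \<sim> z\<close>. It is
      applied with \<open>y\<close> and with \<open>\<sim> x \<oplus> y\<close> for
      \<open>w\<close>.\<close>
    have *: "z \<oplus> w \<odot> \<sim> z = (z \<oplus> w) \<oplus> \<zero> \<odot> \<sim> z" if w: "w \<in> A" for w
    proof -
      have "z \<oplus> (\<one> \<oplus> \<sim> z) = z \<oplus> \<sim> z"
        using xyz R join_left_comm[of z \<one> "\<sim> z"] by simp
      then have "z \<oplus> w \<odot> \<sim> z = (z \<oplus> w) \<odot> (z \<oplus> (\<one> \<oplus> \<sim> z))"
        using w xyz by (simp add: join_meet_distrib)
      also have "\<dots> = z \<oplus> w \<odot> (\<one> \<oplus> \<sim> z)"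
        using w xyz by (simp add: join_meet_distrib)
      finally show ?thesis
        using w xyz by (simp add: meet_top_join join_assoc)
    qed
    have "x \<leadsto> (y \<leadsto> z) \<leadsto> z = \<sim> x \<oplus> (z \<oplus> y \<odot> \<sim> z)"
      using xyz by (simp add: join_comm meet_comm)
    also have "\<dots> = z \<oplus> (\<sim> x \<oplus> y) \<oplus> \<zero> \<odot> \<sim> z"
      using xyz by (simp add: *) (simp add: join_ac)
    also have "\<dots> = ((x \<leadsto> y) \<leadsto> z) \<leadsto> z"
      using xyz by (simp flip: *) (simp add: join_comm meet_comm)
    finally show "x \<leadsto> (y \<leadsto> z) \<leadsto> z = ((x \<leadsto> y) \<leadsto> z) \<leadsto> z" .
  qed
qed

lemma B25:
  "x \<in> A \<Longrightarrow> y \<in> A \<Longrightarrow> z \<in> A \<Longrightarrow> x \<leadsto> (y \<leadsto> x) \<leadsto> z = ((x \<leadsto> y) \<leadsto> x) \<leadsto> z"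
  by (simp add: meet_comm[of _ "\<sim> x"] meet_join_distrib join_assoc)

end

section \<open>The variety \<open>\<S>\<close>\<close>

primrec vars :: "trm \<Rightarrow> nat set" where
  "vars (Var n) = {n}"
| "vars Zero = {}"
| "vars (s \<rightarrow>\<^sub>z t) = vars s \<union> vars t"

lemma eval_cong: "(\<And>n. n \<in> vars t \<Longrightarrow> v n = w n) \<Longrightarrow> eval G v t = eval G w t"
  by (induction t) auto

text \<open>All indices from 2 on share the value \<open>z\<close>, so the range stays inside any
  carrier containing the three arguments.\<close>

definition val3 :: "'a \<Rightarrow> 'a \<Rightarrow> 'a \<Rightarrow> nat \<Rightarrow> 'a" where
  "val3 x y z n = (if n = 0 then x else if n = 1 then y else z)"

lemma val3_simps [simp]: "val3 x y z 0 = x" "val3 x y z (Suc 0) = y" "val3 x y z 2 = z"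
  by (simp_all add: val3_def)

lemma satisfies_iff_val3:
  assumes "vars s \<union> vars t \<subseteq> {0, 1, 2}"
  shows "satisfies G (s \<approx> t) \<longleftrightarrow>
    (\<forall>x\<in>carrier G. \<forall>y\<in>carrier G. \<forall>z\<in>carrier G.
      eval G (val3 x y z) s = eval G (val3 x y z) t)" (is "_ \<longleftrightarrow> ?R")
proof
  assume "satisfies G (s \<approx> t)"
  moreover have "range (val3 x y z) \<subseteq> carrier G"
    if "x \<in> carrier G" "y \<in> carrier G" "z \<in> carrier G" for x y z
    using that by (auto simp: val3_def)
  ultimately show ?R by (simp add: satisfies_def)
next
  assume R: ?R
  have "eval G v s = eval G v t" if "range v \<subseteq> carrier G" for v
  proof -
    have "eval G v u = eval G (val3 (v 0) (v 1) (v 2)) u" if "vars u \<subseteq> {0, 1, 2}" for u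
      using that by (intro eval_cong) (auto simp: val3_def)
    moreover have "v n \<in> carrier G" for n using that by auto
    ultimately show ?thesis using R assms by simp
  qed
  then show "satisfies G (s \<approx> t)" by (simp add: satisfies_def)
qed

lemma satisfies_bol_moufang_iff:
  "satisfies G (bol_moufang X i j) \<longleftrightarrow>
    (\<forall>x\<in>carrier G. \<forall>y\<in>carrier G. \<forall>z\<in>carrier G.
      eval G (val3 x y z) (bracket i (letters X)) = eval G (val3 x y z) (bracket j (letters X)))"
proof -
  have "vars (bracket k (letters X)) \<subseteq> {0, 1, 2}" for k
    by (cases k; cases X) auto
  then show ?thesis
    unfolding bol_moufang_def by (intro satisfies_iff_val3) blast
qed

lemma S_sub_eq: "S_sub X i j = {G \<in> S_variety. satisfies G (bol_moufang X i j)}"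
  by (auto simp: S_sub_def S_variety_def variety_def)

section \<open>Members of \<open>S_variety\<close> as De Morgan bisemilattices\<close>

definition S_neg :: "'a zroupoid \<Rightarrow> 'a \<Rightarrow> 'a" where
  "S_neg G x = imp G x (zero G)"

definition S_join :: "'a zroupoid \<Rightarrow> 'a \<Rightarrow> 'a \<Rightarrow> 'a" where
  "S_join G x y = imp G (S_neg G x) y"

definition S_meet :: "'a zroupoid \<Rightarrow> 'a \<Rightarrow> 'a \<Rightarrow> 'a" where
  "S_meet G x y = S_neg G (imp G x (S_neg G y))"

lemma S_variety_demorgan:
  assumes G: "G \<in> S_variety"
  shows "demorgan_bisemilattice (carrier G) (S_join G) (S_meet G) (zero G) (S_neg G (zero G))
    (S_neg G) (imp G)"
proof -
  let ?A = "carrier G" and ?n = "S_neg G"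
  have zero: "zero G \<in> ?A" and closed: "\<And>a b. a \<in> ?A \<Longrightarrow> b \<in> ?A \<Longrightarrow> imp G a b \<in> ?A"
    using G by (auto simp: S_variety_def variety_def is_zroupoid_def)
  have neg: "\<And>a. a \<in> ?A \<Longrightarrow> ?n a \<in> ?A"
    by (simp add: S_neg_def zero closed)
  have sat: "eval G (val3 x y z) s = eval G (val3 x y z) t"
    if "(s \<approx> t) \<in> S_identities" "x \<in> ?A" "y \<in> ?A" "z \<in> ?A" for s t x y z
  proof -
    have "range (val3 x y z) \<subseteq> ?A" using that by (auto simp: val3_def)
    then show ?thesis
      using G that(1) by (fastforce simp: S_variety_def variety_def satisfies_def)
  qed
  have I: "imp G (imp G x y) z = ?n (imp G (imp G (?n z) x) (?n (imp G y z)))"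
    if "x \<in> ?A" "y \<in> ?A" "z \<in> ?A" for x y z
    using sat[of "(vx \<rightarrow>\<^sub>z vy) \<rightarrow>\<^sub>z vz" "((vz\<acute> \<rightarrow>\<^sub>z vx) \<rightarrow>\<^sub>z (vy \<rightarrow>\<^sub>z vz)\<acute>)\<acute>" x y z] that
    by (simp add: S_identities_def I_identities_def S_neg_def)
  have neg_neg: "?n (?n x) = x" if "x \<in> ?A" for x
    using sat[of "vx\<acute>\<acute>" vx x x x] that by (simp add: S_identities_def S_neg_def)
  have "?n (imp G x (?n y)) = ?n (imp G y (?n x))" if "x \<in> ?A" "y \<in> ?A" for x y
    using sat[of "(vx \<rightarrow>\<^sub>z vy\<acute>)\<acute>" "(vy \<rightarrow>\<^sub>z vx\<acute>)\<acute>" x y x] that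
    by (simp add: S_identities_def S_neg_def)
  \<comment> \<open>The involution cancels the outer negation; this contraposition law makes both
    operations commutative.\<close>
  then have contra: "imp G x (?n y) = imp G y (?n x)" if "x \<in> ?A" "y \<in> ?A" for x y
    using that by (metis neg_neg closed neg)
  have join_comm: "S_join G x y = S_join G y x" if "x \<in> ?A" "y \<in> ?A" for x y
    using that contra[of "?n x" "?n y"] by (simp add: S_join_def neg neg_neg)
  have meet_comm: "S_meet G x y = S_meet G y x" if "x \<in> ?A" "y \<in> ?A" for x y
    using that contra[of x y] by (simp add: S_meet_def)
  have neg_meet: "?n (S_meet G x y) = S_join G (?n x) (?n y)" if "x \<in> ?A" "y \<in> ?A" for x y
    using that by (simp add: S_meet_def S_join_def neg neg_neg closed)
  have neg_join: "?n (S_join G x y) = S_meet G (?n x) (?n y)" if "x \<in> ?A" "y \<in> ?A" for x y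
    using that by (simp add: S_meet_def S_join_def neg neg_neg closed)
  have cl: "S_join G x y \<in> ?A" "S_meet G x y \<in> ?A" if "x \<in> ?A" "y \<in> ?A" for x y
    using that by (simp_all add: S_meet_def S_join_def neg closed)
  have distrib: "S_join G x (S_meet G y z) = S_meet G (S_join G x y) (S_join G x z)"
    if "x \<in> ?A" "y \<in> ?A" "z \<in> ?A" for x y z
  proof -
    have "S_join G x (S_meet G y z) = imp G (imp G y (?n z)) x"
      using that by (simp add: join_comm[of x] cl) (simp add: S_join_def S_meet_def neg_neg neg closed)
    \<comment> \<open>Identity (I) at \<open>y\<close>, \<open>?n z\<close>, \<open>x\<close> is
      exactly distributivity; the other distributive law follows by negation.\<close>
    also have "\<dots> = S_meet G (S_join G x y) (S_join G z x)"
      using that I[of y "?n z" x] by (simp add: S_join_def S_meet_def neg)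
    finally show ?thesis using that by (simp add: join_comm[of z])
  qed
  have distrib': "S_meet G x (S_join G y z) = S_join G (S_meet G x y) (S_meet G x z)"
    if "x \<in> ?A" "y \<in> ?A" "z \<in> ?A" for x y z
  proof -
    have "?n (S_meet G x (S_join G y z)) = ?n (S_join G (S_meet G x y) (S_meet G x z))"
      using that distrib[of "?n x" "?n y" "?n z"] by (simp add: neg_meet neg_join cl neg)
    then show ?thesis using that by (metis neg_neg cl)
  qed
  have unit: "S_join G x (zero G) = x" if "x \<in> ?A" for x
    using that neg_neg[of x] by (simp add: S_join_def S_neg_def)
  have unit': "S_meet G x (?n (zero G)) = x" if "x \<in> ?A" for x
    using that zero by (simp add: S_meet_def neg_neg) (simp flip: S_neg_def add: neg_neg)
  have imp: "imp G x y = S_join G (?n x) y" if "x \<in> ?A" for x y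
    using that by (simp add: S_join_def neg_neg)
  show ?thesis
    by unfold_locales
      (fact cl neg zero join_comm meet_comm distrib distrib' unit unit' neg_neg neg_meet neg_join
        | simp add: neg zero imp)+
qed

theorem theorem4p1:
  shows
    "((S_sub WA Br2 Br3 :: 'a zroupoid set) = S_sub WA Br2 Br5 \<and>
      (S_sub WA Br2 Br5 :: 'a zroupoid set) = S_sub WC Br2 Br5 \<and>
      (S_sub WC Br2 Br5 :: 'a zroupoid set) = S_sub WD Br2 Br5 \<and>
      (S_sub WD Br2 Br5 :: 'a zroupoid set) = S_sub WE Br2 Br5) \<and>
     ((S_sub WA Br1 Br2 :: 'a zroupoid set) = S_sub WB Br1 Br3 \<and>
      (S_sub WB Br1 Br3 :: 'a zroupoid set) = S_sub WD Br1 Br2 \<and>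
      (S_sub WD Br1 Br2 :: 'a zroupoid set) = S_sub WD Br3 Br5 \<and>
      (S_sub WD Br3 Br5 :: 'a zroupoid set) = S_sub WF Br1 Br3) \<and>
     (S_sub WA Br3 Br5 :: 'a zroupoid set) = S_sub WF Br2 Br5 \<and>
     (S_sub WB Br2 Br5 :: 'a zroupoid set) = S_variety"
proof -
  note dm = S_variety_demorgan
  note a = dm[THEN demorgan_bisemilattice.trivial_iff_A23]
    dm[THEN demorgan_bisemilattice.trivial_iff_A25]
    dm[THEN demorgan_bisemilattice.trivial_iff_C25]
    dm[THEN demorgan_bisemilattice.trivial_iff_D25]
    dm[THEN demorgan_bisemilattice.trivial_iff_E25]
  note b = dm[THEN demorgan_bisemilattice.fibrewise_boolean_iff_A12]
    dm[THEN demorgan_bisemilattice.fibrewise_boolean_iff_B13]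
    dm[THEN demorgan_bisemilattice.fibrewise_boolean_iff_D12]
    dm[THEN demorgan_bisemilattice.fibrewise_boolean_iff_D35]
    dm[THEN demorgan_bisemilattice.fibrewise_boolean_iff_F13]
  note c = dm[THEN demorgan_bisemilattice.join_neg_top_iff_A35]
    dm[THEN demorgan_bisemilattice.join_neg_top_iff_F25]
  note d = dm[THEN demorgan_bisemilattice.B25]
  show ?thesis
    unfolding S_sub_eq satisfies_bol_moufang_iff
    \<comment> \<open>The equivalences hold only for members of \<open>S_variety\<close>;
      \<open>conj_cong\<close> makes that membership available while the second conjunct is
      rewritten.\<close>
    by (auto simp: a b c d cong: conj_cong)
qed

end
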